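(* Let $f:\mathbb{R}^n\to\mathbb{R}$ be convex, twice continuously differentiable, coercive, and strongly convex on bounded subsets of $\mathbb{R}^n$. Let $\beta>0$, $x_0,\dot x_0\in\mathbb{R}^n$. Let $\alpha:[0,+\infty)\to\mathbb{R}$ be non-increasing, non-negative and differentiable, and let $\varepsilon:[0,+\infty)\to\mathbb{R}$ be non-increasing, positive, and twice differentiable with bounded second derivative. Then there exists a unique global solution $x:[0,+\infty)\to\mathbb{R}^n$ to $$\varepsilon(t)\ddot x(t)+\alpha(t)\dot x(t)+\beta\nabla^2 f(x(t))\dot x(t)+\nabla f(x(t))=0,\quad t\ge 0,$$ with initial condition $(x(0),\dot x(0))=(x_0,\dot x_0)$.
   Context: $\mathbb{R}^n$ is equipped with a scalar product $\langle\cdot,\cdot\rangle$ and the induced norm $\|\cdot\|$. Coercive means $f(y)\to+\infty$ as $\|y\|\to+\infty$. Strongly convex on bounded subsets means that for every bounded set $K\subset\mathbb{R}^n$ there is $\mu_K>0$ such that $\langle\nabla f(y_1)-\nabla f(y_2),y_1-y_2\rangle\ge\mu_K\|y_1-y_2\|^2$ for all $y_1,y_2\in K$. Dots denote time derivatives; a solution is a twice differentiable function satisfying the equation on $[0,+\infty)$. *)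

theory Defs
  imports "HOL-Analysis.Analysis"
begin

text \<open>
  Euclidean \<open>n\<close>-space with a scalar product is a type of class \<^class>\<open>euclidean_space\<close>; the gradient is
  taken with respect to that scalar product. Gradient and Hessian are only meaningful where the
  corresponding derivative exists.
\<close>

definition grad :: "('a::euclidean_space \<Rightarrow> real) \<Rightarrow> 'a \<Rightarrow> 'a" where
  "grad f x = (THE D. GDERIV f x :> D)"

definition hessian :: "('a::euclidean_space \<Rightarrow> real) \<Rightarrow> 'a \<Rightarrow> 'a \<Rightarrow> 'a" where
  "hessian f x = frechet_derivative (grad f) (at x)"

text \<open>The Hessian depends continuously on the point in the operator norm.\<close>

definition twice_continuously_differentiable :: "('a::euclidean_space \<Rightarrow> real) \<Rightarrow> bool" where
  "twice_continuously_differentiable f \<longleftrightarrow>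
     f differentiable_on UNIV \<and> grad f differentiable_on UNIV \<and>
     continuous_on UNIV (\<lambda>x. Blinfun (hessian f x))"

definition coercive :: "('a::euclidean_space \<Rightarrow> real) \<Rightarrow> bool" where
  "coercive f \<longleftrightarrow> filterlim f at_top at_infinity"

definition strongly_convex_on_bounded :: "('a::euclidean_space \<Rightarrow> real) \<Rightarrow> bool" where
  "strongly_convex_on_bounded f \<longleftrightarrow>
     (\<forall>K. bounded K \<longrightarrow>
       (\<exists>\<mu>>0. \<forall>y1\<in>K. \<forall>y2\<in>K.
          (grad f y1 - grad f y2) \<bullet> (y1 - y2) \<ge> \<mu> * (norm (y1 - y2))\<^sup>2))"

text \<open>
  Time derivative of a function on the half-line \<open>{0..}\<close>: one-sided at \<open>0\<close>, and independent of the
  values at negative times.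
\<close>

definition time_deriv :: "(real \<Rightarrow> 'a::real_normed_vector) \<Rightarrow> real \<Rightarrow> 'a" where
  "time_deriv g t = vector_derivative g (at t within {0..})"

definition twice_differentiable :: "(real \<Rightarrow> 'a::real_normed_vector) \<Rightarrow> bool" where
  "twice_differentiable g \<longleftrightarrow>
     g differentiable_on {0..} \<and> time_deriv g differentiable_on {0..}"

definition global_solution ::
    "('a::euclidean_space \<Rightarrow> real) \<Rightarrow> real \<Rightarrow> (real \<Rightarrow> real) \<Rightarrow> (real \<Rightarrow> real) \<Rightarrow> 'a \<Rightarrow> 'a \<Rightarrow>
     (real \<Rightarrow> 'a) \<Rightarrow> bool" where
  "global_solution f \<beta> \<alpha> \<epsilon> x0 v0 x \<longleftrightarrow>
     twice_differentiable x \<and>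
     (\<forall>t\<ge>0. \<epsilon> t *\<^sub>R time_deriv (time_deriv x) t + \<alpha> t *\<^sub>R time_deriv x t
             + \<beta> *\<^sub>R hessian f (x t) (time_deriv x t) + grad f (x t) = 0) \<and>
     x 0 = x0 \<and> time_deriv x 0 = v0"

end

theory Submission
  imports Defs
begin

text \<open>
  The Hessian is merely continuous, so the equation is not locally Lipschitz in \<open>(x, x')\<close>. In the
  variables \<open>x\<close> and \<open>u = \<epsilon> x' + \<beta> \<nabla>f(x)\<close> the Hessian disappears: \<open>x' = (u - \<beta> \<nabla>f(x)) / \<epsilon>\<close> and
  \<open>u' = (\<epsilon>' - \<alpha>) x' - \<nabla>f(x)\<close>, which is locally Lipschitz because \<open>\<nabla>f\<close> is continuously differentiable.
  Composing \<open>\<nabla>f\<close> with the projection onto a large ball makes the field globally Lipschitz, hence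
  globally solvable. The energy \<open>f(x) + \<epsilon> \<parallel>x'\<parallel>\<^sup>2 / 2\<close> is non-increasing as long as \<open>x\<close> stays in that
  ball, and coercivity turns this into a bound on \<open>x\<close> that is strictly smaller than the radius,
  so the projection is never active. Uniqueness follows from the Lipschitz bound by a Gronwall
  argument.
\<close>

section \<open>Ordinary differential equations\<close>

text \<open>Differentiability at the endpoints is only one-sided: the mean value argument uses
  interior derivatives and continuity up to the boundary, and both follow from derivatives within
  the interval.\<close>

lemma nonpos_deriv_imp_le:
  fixes f :: "real \<Rightarrow> real"
  assumes "a \<le> b"
    and deriv: "\<And>x. x \<in> {a..b} \<Longrightarrow> (f has_real_derivative f' x) (at x within {a..b})"
    and nonpos: "\<And>x. x \<in> {a..b} \<Longrightarrow> f' x \<le> 0"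
  shows "f b \<le> f a"
proof (rule DERIV_nonpos_imp_decreasing_open[OF \<open>a \<le> b\<close>])
  show "continuous_on {a..b} f"
    by (rule DERIV_continuous_on[OF deriv])
  fix x assume "a < x" "x < b"
  then show "\<exists>y. DERIV f x :> y \<and> y \<le> 0"
    using deriv[of x] nonpos[of x] by (auto simp: at_within_Icc_at)
qed

text \<open>Gronwall in differential form: by Cauchy-Schwarz the derivative of
  \<open>d s \<bullet> d s\<close> is at most \<open>2 * L\<close> times its value, so the weight
  \<open>exp (- (2 * L * s))\<close> makes it non-increasing, and it starts at 0. Applied to the
  difference of two solutions, this gives uniqueness for Lipschitz fields.\<close>

lemma linear_growth_zero:
  fixes d :: "real \<Rightarrow> 'b::real_inner"
  assumes deriv: "\<And>t. t \<in> {0..T} \<Longrightarrow> (d has_vector_derivative d' t) (at t within {0..T})"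
    and bound: "\<And>t. t \<in> {0..T} \<Longrightarrow> norm (d' t) \<le> L * norm (d t)"
    and "d 0 = 0" and "t \<in> {0..T}"
  shows "d t = 0"
proof -
  define \<phi> where "\<phi> = (\<lambda>s. exp (- (2 * L * s)) * (d s \<bullet> d s))"
  define \<phi>' where "\<phi>' = (\<lambda>s. exp (- (2 * L * s)) * (2 * (d s \<bullet> d' s) - 2 * L * (d s \<bullet> d s)))"
  have \<phi>: "(\<phi> has_real_derivative \<phi>' s) (at s within {0..T})" if "s \<in> {0..T}" for s
  proof -
    have "((\<lambda>s. d s \<bullet> d s) has_real_derivative d s \<bullet> d' s + d' s \<bullet> d s) (at s within {0..T})"
      using bounded_bilinear.has_vector_derivative[OF bounded_bilinear_inner deriv[OF that] deriv[OF that]]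
      by (simp add: has_real_derivative_iff_has_vector_derivative)
    moreover have "((\<lambda>s. exp (- (2 * L * s))) has_real_derivative exp (- (2 * L * s)) * - (2 * L)) (at s within {0..T})"
      by (auto intro!: derivative_eq_intros)
    ultimately have "(\<phi> has_real_derivative exp (- (2 * L * s)) * - (2 * L) * (d s \<bullet> d s)
        + (d s \<bullet> d' s + d' s \<bullet> d s) * exp (- (2 * L * s))) (at s within {0..T})"
      unfolding \<phi>_def by (rule DERIV_mult[rotated])
    then show ?thesis
      by (simp add: \<phi>'_def inner_commute algebra_simps)
  qed
  have nonpos: "\<phi>' s \<le> 0" if "s \<in> {0..T}" for s
  proof -
    have "d s \<bullet> d' s \<le> norm (d s) * norm (d' s)"
      by (rule norm_cauchy_schwarz)
    also have "\<dots> \<le> norm (d s) * (L * norm (d s))"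
      by (intro mult_left_mono bound that) auto
    also have "\<dots> = L * (d s \<bullet> d s)"
      by (simp add: dot_square_norm power2_eq_square)
    finally show ?thesis
      unfolding \<phi>'_def by (intro mult_nonneg_nonpos) auto
  qed
  have "\<phi> t \<le> \<phi> 0"
  proof (rule nonpos_deriv_imp_le[where f = \<phi> and f' = \<phi>'])
    show "(\<phi> has_real_derivative \<phi>' s) (at s within {0..t})" if "s \<in> {0..t}" for s
      using that \<open>t \<in> {0..T}\<close> by (intro DERIV_subset[OF \<phi>]) auto
  qed (use \<open>t \<in> {0..T}\<close> nonpos in auto)
  then have "exp (- (2 * L * t)) * (d t \<bullet> d t) \<le> 0"
    using \<open>d 0 = 0\<close> by (simp add: \<phi>_def)
  then show ?thesis
    by (simp only: mult_le_0_iff not_exp_le_zero exp_ge_zero inner_gt_zero_iff) (metis inner_gt_zero_iff linorder_not_le)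
qed

text \<open>Picard-Lindelof with an exponentially weighted sup norm (Bielecki): because the field is
  Lipschitz on the whole space, a single fixed point covers the entire interval, whatever its
  length.\<close>

lemma ode_exists_interval:
  fixes F :: "real \<Rightarrow> 'b::banach \<Rightarrow> 'b"
  assumes "T \<ge> 0"
    and cont: "continuous_on ({0..T} \<times> UNIV) (\<lambda>(t, z). F t z)"
    and lip: "\<And>t z w. t \<in> {0..T} \<Longrightarrow> norm (F t z - F t w) \<le> L * norm (z - w)"
  obtains z where "z 0 = z0"
    and "\<And>t. t \<in> {0..T} \<Longrightarrow> (z has_vector_derivative F t (z t)) (at t within {0..T})"
proof -
  \<comment> \<open>Integrating the Lipschitz bound against the weight produces the factor
    \<open>\<bar>L\<bar> / c\<close>. This choice makes it at most 1/2, and the summand 1 keeps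
    \<open>c\<close> positive when \<open>L = 0\<close>.\<close>
  define c where "c = 2 * \<bar>L\<bar> + 1"
  have "c > 0" unfolding c_def by simp
  define h where "h = (\<lambda>(y :: real \<Rightarrow>\<^sub>C 'b) r. F r (exp (c * r) *\<^sub>R apply_bcontfun y r))"
  have h: "continuous_on {0..T} (h y)" for y
  proof -
    have "continuous_on {0..T} (apply_bcontfun y)"
      using continuous_on_apply_bcontfun continuous_on_subset by blast
    then have "continuous_on {0..T} ((\<lambda>(t, z). F t z) \<circ> (\<lambda>r. (r, exp (c * r) *\<^sub>R apply_bcontfun y r)))"
      by (intro continuous_on_compose continuous_on_subset[OF cont] continuous_intros) auto
    then show ?thesis by (simp add: h_def o_def)
  qed
  (* y is the solution scaled by exp (-ct): with this weight Picard's map is a 1/2-contraction on all of {0..T}. *)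
  define G where "G = (\<lambda>y t. exp (- c * t) *\<^sub>R (z0 + integral {0..t} (h y)))"
  \<comment> \<open>Clamping time to \<open>{0..T}\<close> extends \<open>G y\<close> to a bounded
    continuous function on all of the reals, so the fixed point can be sought in the complete space
    of such functions.\<close>
  define \<sigma> where "\<sigma> = (\<lambda>t. max 0 (min T t))"
  have \<sigma>: "\<sigma> t \<in> {0..T}" for t using \<open>T \<ge> 0\<close> by (auto simp: \<sigma>_def)
  have G: "continuous_on {0..T} (G y)" for y
    unfolding G_def by (intro continuous_intros indefinite_integral_continuous_1 integrable_continuous_interval h)
  have G\<sigma>: "(\<lambda>t. G y (\<sigma> t)) \<in> bcontfun" for y
  proof -
    have "continuous_on UNIV (\<lambda>t. G y (\<sigma> t))"
      by (rule continuous_on_compose2[OF G]) (auto simp: \<sigma>_def \<open>T \<ge> 0\<close> intro!: continuous_intros)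
    moreover have "bounded (G y ` {0..T})"
      by (intro compact_imp_bounded compact_continuous_image G) auto
    then have "bounded (range (\<lambda>t. G y (\<sigma> t)))"
      by (rule bounded_subset) (use \<sigma> in auto)
    ultimately show ?thesis by (simp add: bcontfun_def)
  qed
  define \<Phi> where "\<Phi> = (\<lambda>y. Bcontfun (\<lambda>t. G y (\<sigma> t)))"
  have \<Phi>: "apply_bcontfun (\<Phi> y) t = G y (\<sigma> t)" for y t
    unfolding \<Phi>_def by (simp add: Bcontfun_inverse[OF G\<sigma>])
  have "dist (\<Phi> y) (\<Phi> w) \<le> (1/2) * dist y w" for y w
  proof (rule dist_bound)
    fix t
    define s where "s = \<sigma> t"
    have s: "0 \<le> s" "s \<le> T" using \<sigma>[of t] by (auto simp: s_def)
    define D where "D = dist y w"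
    have int: "(\<lambda>r. h y r) integrable_on {0..s}" for y
      using s by (intro integrable_continuous_interval continuous_on_subset[OF h]) auto
    \<comment> \<open>The primitive of the integrand is
      \<open>\<bar>L\<bar> * D * exp (c * r) / c\<close>; the division by \<open>c\<close> is the
      source of the contraction factor.\<close>
    have *: "((\<lambda>r. \<bar>L\<bar> * exp (c * r) * D) has_integral \<bar>L\<bar> * D * exp (c * s) / c - \<bar>L\<bar> * D * exp (c * 0) / c) {0..s}"
      using s \<open>c > 0\<close>
      by (intro fundamental_theorem_of_calculus)
         (auto intro!: derivative_eq_intros simp: has_real_derivative_iff_has_vector_derivative[symmetric] field_simps)
    have "norm (integral {0..s} (h y) - integral {0..s} (h w)) = norm (integral {0..s} (\<lambda>r. h y r - h w r))"
      using Henstock_Kurzweil_Integration.integral_diff[OF int int] by simp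
    also have "\<dots> \<le> integral {0..s} (\<lambda>r. \<bar>L\<bar> * exp (c * r) * D)"
    proof (intro integral_norm_bound_integral)
      show "(\<lambda>r. h y r - h w r) integrable_on {0..s}" by (intro integrable_diff int)
      show "(\<lambda>r. \<bar>L\<bar> * exp (c * r) * D) integrable_on {0..s}" using * by (rule has_integral_integrable)
      fix r assume r: "r \<in> {0..s}"
      have "norm (h y r - h w r) \<le> L * norm (exp (c * r) *\<^sub>R apply_bcontfun y r - exp (c * r) *\<^sub>R apply_bcontfun w r)"
        unfolding h_def using r s by (intro lip) auto
      also have "\<dots> = L * (exp (c * r) * dist (apply_bcontfun y r) (apply_bcontfun w r))"
        by (simp add: dist_norm flip: scaleR_diff_right)
      also have "\<dots> \<le> \<bar>L\<bar> * (exp (c * r) * D)"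
        unfolding D_def by (intro mult_mono dist_bounded) auto
      finally show "norm (h y r - h w r) \<le> \<bar>L\<bar> * exp (c * r) * D" by (simp add: mult.assoc)
    qed
    also have "\<dots> = \<bar>L\<bar> * D * exp (c * s) / c - \<bar>L\<bar> * D * exp (c * 0) / c"
      using * by (rule integral_unique)
    also have "\<dots> \<le> \<bar>L\<bar> * D * exp (c * s) / c"
      using \<open>c > 0\<close> by (simp add: D_def)
    also have "\<dots> \<le> (1/2) * D * exp (c * s)"
    proof -
      have "\<bar>L\<bar> / c \<le> 1/2" by (simp add: c_def field_simps)
      then have "\<bar>L\<bar> / c * (D * exp (c * s)) \<le> 1/2 * (D * exp (c * s))"
        by (intro mult_right_mono) (auto simp: D_def)
      then show ?thesis by (simp add: mult.assoc)
    qed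
    finally have "norm (integral {0..s} (h y) - integral {0..s} (h w)) \<le> (1/2) * D * exp (c * s)" .
    \<comment> \<open>The weight in \<open>G\<close> cancels the growth \<open>exp (c * s)\<close>
      of the integral bound, so the estimate is uniform in \<open>s\<close>.\<close>
    then have "exp (- c * s) * norm (integral {0..s} (h y) - integral {0..s} (h w)) \<le> exp (- c * s) * ((1/2) * D * exp (c * s))"
      by (intro mult_left_mono) auto
    also have "\<dots> = (1/2) * D"
      by (simp add: exp_minus)
    finally show "dist (apply_bcontfun (\<Phi> y) t) (apply_bcontfun (\<Phi> w) t) \<le> (1/2) * dist y w"
      by (simp add: \<Phi> G_def dist_norm D_def flip: s_def scaleR_diff_right)
  qed
  then obtain y where y: "\<Phi> y = y"
    using banach_fix_type[of "1/2" \<Phi>] by auto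
  \<comment> \<open>Undoing the scaling: the integral form is differentiable at once, and the
    fixed-point equation identifies it with the rescaled \<open>y\<close> on
    \<open>{0..T}\<close>.\<close>
  define z where "z = (\<lambda>t. z0 + integral {0..t} (h y))"
  have z: "exp (c * t) *\<^sub>R apply_bcontfun y t = z t" if "t \<in> {0..T}" for t
  proof -
    have "\<sigma> t = t" using that by (auto simp: \<sigma>_def)
    then have "apply_bcontfun y t = exp (- c * t) *\<^sub>R z t"
      using \<Phi>[of y t] by (simp add: y G_def z_def)
    then show ?thesis by (simp add: exp_minus)
  qed
  show thesis
  proof (rule that)
    show "z 0 = z0" by (simp add: z_def)
    fix t assume t: "t \<in> {0..T}"
    have "(z has_vector_derivative 0 + h y t) (at t within {0..T})"
      unfolding z_def by (intro has_vector_derivative_add has_vector_derivative_const integral_has_vector_derivative h t)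
    then show "(z has_vector_derivative F t (z t)) (at t within {0..T})"
      using z[OF t] by (simp add: h_def)
  qed
qed

text \<open>Solutions on the intervals \<open>{0..T}\<close> are glued: by
  \<open>linear_growth_zero\<close>, a solution on a longer interval restricts to the one on a
  shorter interval. The Lipschitz constant may therefore depend on \<open>T\<close>.\<close>

lemma ode_exists_halfline:
  fixes F :: "real \<Rightarrow> 'b::{real_inner, banach} \<Rightarrow> 'b"
  assumes cont: "continuous_on ({0..} \<times> UNIV) (\<lambda>(t, z). F t z)"
    and lip: "\<And>T. T \<ge> 0 \<Longrightarrow> \<exists>L. \<forall>t\<in>{0..T}. \<forall>z w. norm (F t z - F t w) \<le> L * norm (z - w)"
  obtains z where "z 0 = z0"
    and "\<And>t. t \<ge> 0 \<Longrightarrow> (z has_vector_derivative F t (z t)) (at t within {0..})"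
proof -
  define sol where "sol = (\<lambda>T z. z 0 = z0 \<and>
    (\<forall>t\<in>{0..T}. (z has_vector_derivative F t (z t)) (at t within {0..T})))"
  have "\<exists>z. sol T z" if "T \<ge> 0" for T
  proof -
    obtain L where L: "\<forall>t\<in>{0..T}. \<forall>z w. norm (F t z - F t w) \<le> L * norm (z - w)"
      using lip[OF \<open>T \<ge> 0\<close>] by auto
    have "continuous_on ({0..T} \<times> UNIV) (\<lambda>(t, z). F t z)"
      by (rule continuous_on_subset[OF cont]) auto
    with \<open>T \<ge> 0\<close> obtain z where "z 0 = z0"
      "\<And>t. t \<in> {0..T} \<Longrightarrow> (z has_vector_derivative F t (z t)) (at t within {0..T})"
      by (rule ode_exists_interval[of T F L z0]) (use L in auto)
    then show ?thesis unfolding sol_def by auto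
  qed
  then obtain Z where Z: "\<And>T. T \<ge> 0 \<Longrightarrow> sol T (Z T)"
    by metis
  have agree: "Z S t = Z T t" if "t \<in> {0..S}" "S \<le> T" for S T t
  proof -
    have "S \<ge> 0" "T \<ge> 0" using that by auto
    obtain L where L: "\<forall>t\<in>{0..S}. \<forall>z w. norm (F t z - F t w) \<le> L * norm (z - w)"
      using lip[OF \<open>S \<ge> 0\<close>] by auto
    have "Z S t - Z T t = 0"
    proof (rule linear_growth_zero[where d = "\<lambda>s. Z S s - Z T s" and d' = "\<lambda>s. F s (Z S s) - F s (Z T s)"])
      show "Z S 0 - Z T 0 = 0"
        using Z \<open>S \<ge> 0\<close> \<open>T \<ge> 0\<close> by (simp add: sol_def)
      fix s assume s: "s \<in> {0..S}"
      have "(Z T has_vector_derivative F s (Z T s)) (at s within {0..S})"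
        using Z[OF \<open>T \<ge> 0\<close>] s \<open>S \<le> T\<close> unfolding sol_def
        by (auto intro: has_vector_derivative_within_subset[of _ _ s "{0..T}" "{0..S}"])
      then show "((\<lambda>s. Z S s - Z T s) has_vector_derivative F s (Z S s) - F s (Z T s)) (at s within {0..S})"
        using Z[OF \<open>S \<ge> 0\<close>] s unfolding sol_def by (intro has_vector_derivative_diff) auto
      show "norm (F s (Z S s) - F s (Z T s)) \<le> L * norm (Z S s - Z T s)"
        using L s by blast
    qed (use that in auto)
    then show ?thesis by simp
  qed
  \<comment> \<open>The horizon \<open>t + 1\<close> instead of \<open>t\<close> leaves room to the
    right of \<open>t\<close>, so that the derivative within \<open>{0..t + 1}\<close> is already
    the derivative within the half-line.\<close>
  define z where "z = (\<lambda>t. Z (t + 1) t)"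
  show thesis
  proof (rule that)
    show "z 0 = z0" using Z[of 1] by (simp add: z_def sol_def)
    fix t :: real assume "t \<ge> 0"
    have eq: "z s = Z (t + 1) s" if "s \<in> {0..t + 1}" for s
    proof (cases "s \<le> t")
      case True
      then show ?thesis using agree[of s "s + 1" "t + 1"] that by (simp add: z_def)
    next
      case False
      then show ?thesis using agree[of s "t + 1" "s + 1"] that by (simp add: z_def)
    qed
    have "(Z (t + 1) has_vector_derivative F t (Z (t + 1) t)) (at t within {0..t + 1})"
      using Z[of "t + 1"] \<open>t \<ge> 0\<close> by (simp add: sol_def)
    then have "(z has_vector_derivative F t (z t)) (at t within {0..t + 1})"
      using eq \<open>t \<ge> 0\<close> by (intro has_vector_derivative_transform[of t "{0..t + 1}" z "Z (t + 1)"]) auto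
    moreover have "at t within {0..t + 1} = at t within {0..}"
      by (rule at_within_nhd[of _ "{t - 1<..<t + 1}"]) auto
    ultimately show "(z has_vector_derivative F t (z t)) (at t within {0..})"
      by simp
  qed
qed

section \<open>Gradient and Hessian\<close>

text \<open>Riesz representation: the representing vector is the adjoint of the derivative applied
  to 1, and its uniqueness makes the definite description in \<open>grad\<close> meaningful.\<close>

lemma GDERIV_grad:
  fixes f :: "'a::euclidean_space \<Rightarrow> real"
  assumes "f differentiable (at x)"
  shows "GDERIV f x :> grad f x"
proof -
  obtain f' where f': "(f has_derivative f') (at x)"
    using assms by (auto simp: differentiable_def)
  then interpret bounded_linear f' by (rule has_derivative_bounded_linear)
  define D where "D = adjoint f' 1"
  have D: "f' h = h \<bullet> D" for h
    using adjoint_works[OF linear_axioms, of h 1] by (simp add: D_def inner_commute)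
  have "GDERIV f x :> D"
    using f' by (simp add: gderiv_def flip: D)
  moreover have "D' = D" if "GDERIV f x :> D'" for D'
  proof -
    have "(\<lambda>h. h \<bullet> D') = (\<lambda>h. h \<bullet> D)"
      using \<open>GDERIV f x :> D\<close> that has_derivative_unique unfolding gderiv_def by blast
    then show ?thesis by (metis vector_eq_ldot)
  qed
  ultimately show ?thesis
    unfolding grad_def by (rule theI)
qed

lemma grad_has_derivative_hessian:
  assumes "twice_continuously_differentiable f"
  shows "(grad f has_derivative hessian f x) (at x within S)"
proof -
  have "grad f differentiable (at x)"
    using assms by (auto simp: twice_continuously_differentiable_def differentiable_on_def)
  then show ?thesis
    unfolding hessian_def
    using frechet_derivative_works has_derivative_at_withinI by blast
qed

lemma grad_chain:
  assumes "twice_continuously_differentiable f"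
    and "(x has_vector_derivative v) (at t within S)"
  shows "((\<lambda>s. grad f (x s)) has_vector_derivative hessian f (x t) v) (at t within S)"
proof -
  have "((\<lambda>s. grad f (x s)) has_derivative (\<lambda>s. hessian f (x t) (s *\<^sub>R v))) (at t within S)"
    using has_derivative_compose[OF assms(2)[unfolded has_vector_derivative_def]
        grad_has_derivative_hessian[OF assms(1), of "x t" UNIV]] .
  moreover have "hessian f (x t) (s *\<^sub>R v) = s *\<^sub>R hessian f (x t) v" for s
    using grad_has_derivative_hessian[OF assms(1), of "x t" UNIV]
    by (metis has_derivative_bounded_linear bounded_linear.linear linear_scale)
  ultimately show ?thesis
    by (simp add: has_vector_derivative_def)
qed

text \<open>Strong monotonicity of the gradient on the two-point set \<open>{x, y}\<close> gives
  plain monotonicity. Hence the difference quotients of the gradient in direction \<open>v\<close>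
  have a nonnegative inner product with \<open>v\<close>, and so does their limit.\<close>

lemma hessian_nonneg:
  assumes "twice_continuously_differentiable f"
    and "strongly_convex_on_bounded f"
  shows "0 \<le> v \<bullet> hessian f x v"
proof -
  have mono: "0 \<le> (grad f y - grad f x) \<bullet> (y - x)" for y
  proof -
    have "bounded {x, y}" by simp
    then obtain \<mu> where "\<mu> > 0" "\<mu> * (norm (y - x))\<^sup>2 \<le> (grad f y - grad f x) \<bullet> (y - x)"
      using assms(2) unfolding strongly_convex_on_bounded_def by blast
    moreover have "0 \<le> \<mu> * (norm (y - x))\<^sup>2"
      using \<open>\<mu> > 0\<close> by simp
    ultimately show ?thesis by linarith
  qed
  have "((\<lambda>s. x + s *\<^sub>R v) has_vector_derivative v) (at 0)"
    by (auto intro!: derivative_eq_intros)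
  from bounded_linear.has_vector_derivative[OF bounded_linear_inner_right grad_chain[OF assms(1) this]]
  have "((\<lambda>s. v \<bullet> grad f (x + s *\<^sub>R v)) has_real_derivative v \<bullet> hessian f x v) (at 0)"
    by (simp add: has_real_derivative_iff_has_vector_derivative)
  then have lim: "((\<lambda>s. (v \<bullet> grad f (x + s *\<^sub>R v) - v \<bullet> grad f x) / s) \<longlongrightarrow> v \<bullet> hessian f x v) (at 0)"
    by (simp add: DERIV_def)
  show ?thesis
  proof (rule tendsto_lowerbound[OF lim])
    have "0 \<le> (v \<bullet> grad f (x + s *\<^sub>R v) - v \<bullet> grad f x) / s" for s
    proof -
      \<comment> \<open>Multiplying by \<open>s\<close> instead of dividing treats both signs of
        \<open>s\<close> together; at \<open>s = 0\<close> the quotient is 0 by convention.\<close>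
      have "0 \<le> s * (v \<bullet> grad f (x + s *\<^sub>R v) - v \<bullet> grad f x)"
        using mono[of "x + s *\<^sub>R v"] by (simp add: inner_diff_left inner_diff_right inner_commute algebra_simps)
      then show ?thesis by (auto simp: zero_le_divide_iff zero_le_mult_iff)
    qed
    then show "\<forall>\<^sub>F s in at 0. 0 \<le> (v \<bullet> grad f (x + s *\<^sub>R v) - v \<bullet> grad f x) / s"
      by simp
  qed simp
qed

text \<open>The continuous Hessian has bounded operator norm on the compact ball, and the mean value
  inequality on this convex set turns that bound into a Lipschitz constant.\<close>

lemma grad_lipschitz_on_cball:
  fixes f :: "'a::euclidean_space \<Rightarrow> real"
  assumes "twice_continuously_differentiable f"
  obtains K where "K \<ge> 0"
    and "\<And>x y. x \<in> cball 0 R \<Longrightarrow> y \<in> cball 0 R \<Longrightarrow> norm (grad f x - grad f y) \<le> K * norm (x - y)"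
proof -
  let ?H = "\<lambda>x. Blinfun (hessian f x)"
  have "compact (?H ` cball 0 R)"
    using assms unfolding twice_continuously_differentiable_def
    by (intro compact_continuous_image) (auto intro: continuous_on_subset)
  then have "bounded (?H ` cball 0 R)"
    by (rule compact_imp_bounded)
  then obtain K where "K > 0" and K: "\<forall>x\<in>cball 0 R. norm (?H x) \<le> K"
    unfolding bounded_pos by auto
  have "onorm (hessian f x) \<le> K" if "x \<in> cball 0 R" for x
  proof -
    have "bounded_linear (hessian f x)"
      using grad_has_derivative_hessian[OF assms] has_derivative_bounded_linear by blast
    then have "norm (?H x) = onorm (hessian f x)"
      by (simp add: norm_blinfun.rep_eq bounded_linear_Blinfun_apply)
    then show ?thesis using bspec[OF K that] by simp
  qed
  then have "norm (grad f x - grad f y) \<le> K * norm (x - y)"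
    if "x \<in> cball 0 R" "y \<in> cball 0 R" for x y
    by (rule differentiable_bound[OF convex_cball grad_has_derivative_hessian[OF assms] _ that])
  with \<open>K > 0\<close> show thesis by (intro that[of K]) auto
qed

text \<open>Projection onto the ball is nonexpansive and fixes the ball pointwise, so precomposing
  with it extends the Lipschitz constant of the gradient on the ball to the whole space.\<close>

lemma grad_truncation:
  fixes f :: "'a::euclidean_space \<Rightarrow> real"
  assumes "twice_continuously_differentiable f" and "R \<ge> 0"
  obtains g :: "'a \<Rightarrow> 'a" and K where "K \<ge> 0"
    and "\<And>x y. norm (g x - g y) \<le> K * norm (x - y)"
    and "\<And>x. norm x \<le> R \<Longrightarrow> g x = grad f x"
proof -
  let ?P = "closest_point (cball (0::'a) R)"
  have ne: "cball (0::'a) R \<noteq> {}" using \<open>R \<ge> 0\<close> by simp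
  have P: "?P x \<in> cball 0 R" for x
    using closest_point_in_set[OF closed_cball ne] .
  obtain K where "K \<ge> 0"
    and K: "\<And>x y. x \<in> cball 0 R \<Longrightarrow> y \<in> cball 0 R \<Longrightarrow> norm (grad f x - grad f y) \<le> K * norm (x - y)"
    using grad_lipschitz_on_cball[OF assms(1), of R] by metis
  show thesis
  proof (rule that[of K "\<lambda>x. grad f (?P x)"])
    fix x y
    have "norm (?P x - ?P y) \<le> norm (x - y)"
      using closest_point_lipschitz[OF convex_cball closed_cball ne, of x y] by (simp add: dist_norm)
    then show "norm (grad f (?P x) - grad f (?P y)) \<le> K * norm (x - y)"
      using K[OF P P, of x y] mult_left_mono[OF _ \<open>K \<ge> 0\<close>] by (meson order_trans)
  qed (use \<open>K \<ge> 0\<close> closest_point_self[of _ "cball (0::'a) R"] in auto)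
qed

lemma coercive_sublevel_bounded:
  assumes "coercive f"
  obtains R where "R > 0" and "\<And>x. f x \<le> c \<Longrightarrow> norm x \<le> R"
proof -
  have "\<forall>\<^sub>F x in at_infinity. c < f x"
    using assms unfolding coercive_def filterlim_at_top_dense by blast
  then obtain b where b: "\<And>x. b \<le> norm x \<Longrightarrow> c < f x"
    unfolding eventually_at_infinity by blast
  have "norm x \<le> max b 1" if "f x \<le> c" for x
    using b[of x] that by linarith
  then show thesis by (intro that[of "max b 1"]) auto
qed

section \<open>Time derivatives on the half-line\<close>

text \<open>The half-line accumulates from the right at each of its points, including 0; this makes
  limits within it, and hence \<open>time_deriv\<close>, unique.\<close>

lemma at_within_halfline_neq_bot:
  fixes t :: real
  assumes "t \<ge> 0"
  shows "at t within {0..} \<noteq> bot"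
proof -
  have "at_right t \<le> at t within {0..}"
    by (rule at_le) (use assms in auto)
  then show ?thesis
    using trivial_limit_at_right_real[of t] bot.extremum_uniqueI by metis
qed

lemma time_deriv_eq:
  assumes "t \<ge> 0" and "(g has_vector_derivative D) (at t within {0..})"
  shows "time_deriv g t = D"
  unfolding time_deriv_def
  using at_within_halfline_neq_bot[OF assms(1)] assms(2) by (rule vector_derivative_within)

lemma has_time_deriv:
  assumes "g differentiable_on {0..}" and "t \<ge> 0"
  shows "(g has_vector_derivative time_deriv g t) (at t within {0..})"
  using assms unfolding time_deriv_def differentiable_on_def by (simp add: vector_derivative_works)

text \<open>Difference quotients of a non-increasing function are nonpositive on either side of
  \<open>t\<close>, and the sign passes to the limit.\<close>

lemma time_deriv_nonpos:
  fixes e :: "real \<Rightarrow> real"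
  assumes "antimono_on {0..} e" and "e differentiable_on {0..}" and "t \<ge> 0"
  shows "time_deriv e t \<le> 0"
proof (rule tendsto_upperbound)
  show "((\<lambda>s. (e s - e t) / (s - t)) \<longlongrightarrow> time_deriv e t) (at t within {0..})"
    using has_time_deriv[OF assms(2,3)]
    by (simp add: has_real_derivative_iff_has_vector_derivative[symmetric] has_field_derivative_iff)
  have "(e s - e t) / (s - t) \<le> 0" if "s \<ge> 0" for s
  proof (cases "s \<le> t")
    case True
    then show ?thesis
      using monotone_onD[OF assms(1), of s t] that \<open>t \<ge> 0\<close> by (auto intro!: divide_nonneg_nonpos)
  next
    case False
    then show ?thesis
      using monotone_onD[OF assms(1), of t s] that \<open>t \<ge> 0\<close> by (auto intro!: divide_nonpos_nonneg)
  qed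
  then show "\<forall>\<^sub>F s in at t within {0..}. (e s - e t) / (s - t) \<le> 0"
    by (auto simp: eventually_at_filter)
qed (rule at_within_halfline_neq_bot[OF assms(3)])

section \<open>First-order formulation\<close>

text \<open>
  The variable \<open>z = (x, u)\<close> with \<open>u = \<epsilon> x' + \<beta> \<nabla>f(x)\<close>; the equation corresponds to \<open>g = \<nabla>f\<close> and
  \<open>\<gamma> = \<epsilon>' - \<alpha>\<close>.
\<close>

definition phase_field ::
    "real \<Rightarrow> (real \<Rightarrow> real) \<Rightarrow> (real \<Rightarrow> real) \<Rightarrow> ('a::real_normed_vector \<Rightarrow> 'a) \<Rightarrow> real \<Rightarrow> 'a \<times> 'a \<Rightarrow> 'a \<times> 'a" where
  "phase_field \<beta> \<epsilon> \<gamma> g t z =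
     (let v = (snd z - \<beta> *\<^sub>R g (fst z)) /\<^sub>R \<epsilon> t in (v, \<gamma> t *\<^sub>R v - g (fst z)))"

lemma continuous_phase_field:
  assumes "continuous_on S \<epsilon>" "continuous_on S \<gamma>" "continuous_on UNIV g"
    and "\<And>t. t \<in> S \<Longrightarrow> \<epsilon> t \<noteq> 0"
  shows "continuous_on (S \<times> UNIV) (\<lambda>(t, z). phase_field \<beta> \<epsilon> \<gamma> g t z)"
proof -
  have "continuous_on (S \<times> UNIV) (\<lambda>p. \<epsilon> (fst p))" "continuous_on (S \<times> UNIV) (\<lambda>p. \<gamma> (fst p))"
    by (rule continuous_on_compose2[OF assms(1)] continuous_on_compose2[OF assms(2)],
        auto intro!: continuous_intros)+
  moreover have "continuous_on (S \<times> UNIV) (\<lambda>p. g (fst (snd p)))"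
    by (rule continuous_on_compose2[OF assms(3)]) (auto intro!: continuous_intros)
  ultimately show ?thesis
    unfolding phase_field_def Let_def case_prod_beta
    using assms(4) by (intro continuous_intros) auto
qed

text \<open>On a compact time interval \<open>inverse (\<epsilon> t)\<close> and
  \<open>\<gamma> t\<close> are bounded. The field is linear in \<open>snd z\<close> and
  \<open>g (fst z)\<close> with coefficients built from them, so it inherits the Lipschitz property
  of \<open>g\<close>.\<close>

lemma phase_field_lipschitz:
  assumes "continuous_on {0..T} \<epsilon>" "continuous_on {0..T} \<gamma>"
    and "\<And>t. t \<in> {0..T} \<Longrightarrow> \<epsilon> t \<noteq> 0"
    and "K \<ge> 0" and lip: "\<And>x y. norm (g x - g y) \<le> K * norm (x - y)"
  shows "\<exists>L. \<forall>t\<in>{0..T}. \<forall>z w.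
    norm (phase_field \<beta> \<epsilon> \<gamma> g t z - phase_field \<beta> \<epsilon> \<gamma> g t w) \<le> L * norm (z - w)"
proof -
  have "bounded ((\<lambda>t. inverse (\<epsilon> t)) ` {0..T})" "bounded (\<gamma> ` {0..T})"
    using assms by (auto intro!: compact_imp_bounded compact_continuous_image continuous_intros)
  then obtain C D where C: "\<forall>t\<in>{0..T}. \<bar>inverse (\<epsilon> t)\<bar> \<le> C" and D: "\<forall>t\<in>{0..T}. \<bar>\<gamma> t\<bar> \<le> D"
    unfolding bounded_iff by auto
  \<comment> \<open>\<open>M\<close> is the Lipschitz constant of the velocity component; the second
    component then has constant \<open>D * M + K\<close>, and the pair at most the sum.\<close>
  define M where "M = C * (1 + \<bar>\<beta>\<bar> * K)"
  show ?thesis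
  proof (intro exI[of _ "M + (D * M + K)"] ballI allI)
    fix t and z w :: "'a \<times> 'a" assume t: "t \<in> {0..T}"
    \<comment> \<open>The signs of the bounds are read off at \<open>t\<close>, since
      \<open>{0..T}\<close> may be empty.\<close>
    have "C \<ge> 0"
      using bspec[OF C t] by linarith
    have "D \<ge> 0"
      using bspec[OF D t] by linarith
    define v where "v = (\<lambda>z. (snd z - \<beta> *\<^sub>R g (fst z)) /\<^sub>R \<epsilon> t)"
    define N where "N = norm (z - w)"
    have fst: "norm (fst z - fst w) \<le> N" and snd: "norm (snd z - snd w) \<le> N"
      unfolding N_def by (metis fst_diff norm_fst_le prod.collapse, metis snd_diff norm_snd_le prod.collapse)
    have g: "norm (g (fst z) - g (fst w)) \<le> K * N"
      using lip[of "fst z" "fst w"] mult_left_mono[OF fst \<open>K \<ge> 0\<close>] by linarith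
    have "v z - v w = inverse (\<epsilon> t) *\<^sub>R ((snd z - snd w) - \<beta> *\<^sub>R (g (fst z) - g (fst w)))"
      by (simp add: v_def algebra_simps)
    then have "norm (v z - v w) = \<bar>inverse (\<epsilon> t)\<bar> * norm ((snd z - snd w) - \<beta> *\<^sub>R (g (fst z) - g (fst w)))"
      by simp
    also have "\<dots> \<le> C * (N + \<bar>\<beta>\<bar> * (K * N))"
    proof (intro mult_mono)
      have "norm ((snd z - snd w) - \<beta> *\<^sub>R (g (fst z) - g (fst w)))
          \<le> norm (snd z - snd w) + \<bar>\<beta>\<bar> * norm (g (fst z) - g (fst w))"
        using norm_triangle_ineq4[of "snd z - snd w" "\<beta> *\<^sub>R (g (fst z) - g (fst w))"] by simp
      also have "\<dots> \<le> N + \<bar>\<beta>\<bar> * (K * N)"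
        by (intro add_mono mult_left_mono snd g) auto
      finally show "norm ((snd z - snd w) - \<beta> *\<^sub>R (g (fst z) - g (fst w))) \<le> N + \<bar>\<beta>\<bar> * (K * N)" .
    qed (use C t \<open>C \<ge> 0\<close> in auto)
    also have "\<dots> = M * N"
      by (simp add: M_def algebra_simps)
    finally have v: "norm (v z - v w) \<le> M * N" .
    have "norm ((\<gamma> t *\<^sub>R v z - g (fst z)) - (\<gamma> t *\<^sub>R v w - g (fst w)))
        = norm (\<gamma> t *\<^sub>R (v z - v w) - (g (fst z) - g (fst w)))"
      by (simp add: algebra_simps)
    also have "\<dots> \<le> \<bar>\<gamma> t\<bar> * norm (v z - v w) + norm (g (fst z) - g (fst w))"
      using norm_triangle_ineq4[of "\<gamma> t *\<^sub>R (v z - v w)" "g (fst z) - g (fst w)"] by simp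
    also have "\<dots> \<le> D * (M * N) + K * N"
      using D t v g \<open>D \<ge> 0\<close> by (intro add_mono mult_mono) auto
    finally have s: "norm ((\<gamma> t *\<^sub>R v z - g (fst z)) - (\<gamma> t *\<^sub>R v w - g (fst w))) \<le> D * (M * N) + K * N" .
    have "norm (phase_field \<beta> \<epsilon> \<gamma> g t z - phase_field \<beta> \<epsilon> \<gamma> g t w)
        = norm (v z - v w, (\<gamma> t *\<^sub>R v z - g (fst z)) - (\<gamma> t *\<^sub>R v w - g (fst w)))"
      by (simp add: phase_field_def v_def)
    also have "\<dots> \<le> M * N + (D * (M * N) + K * N)"
      using norm_Pair_le v s by (meson add_mono order_trans)
    finally show "norm (phase_field \<beta> \<epsilon> \<gamma> g t z - phase_field \<beta> \<epsilon> \<gamma> g t w) \<le> (M + (D * M + K)) * norm (z - w)"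
      by (simp add: N_def algebra_simps)
  qed
qed

text \<open>When the quotient \<open>v\<close> is differentiated, the term
  \<open>\<epsilon>' t *\<^sub>R v t\<close> coming from the second phase variable cancels the one
  from the derivative of the denominator; this is why the field carries the coefficient
  \<open>\<epsilon>' - \<alpha>\<close>. The set \<open>S\<close> is left free so that both the
  half-line and compact intervals are covered.\<close>

lemma phase_velocity_deriv:
  fixes f :: "'a::euclidean_space \<Rightarrow> real" and z :: "real \<Rightarrow> 'a \<times> 'a"
    and \<beta> :: real and \<epsilon> \<epsilon>' :: "real \<Rightarrow> real"
  defines "v \<equiv> \<lambda>s. (snd (z s) - \<beta> *\<^sub>R grad f (fst (z s))) /\<^sub>R \<epsilon> s"
  assumes f: "twice_continuously_differentiable f"
    and z: "(z has_vector_derivative phase_field \<beta> \<epsilon> (\<lambda>s. \<epsilon>' s - \<alpha> s) (grad f) t (z t)) (at t within S)"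
    and \<epsilon>: "(\<epsilon> has_real_derivative \<epsilon>' t) (at t within S)" and "\<epsilon> t \<noteq> 0"
  shows "((\<lambda>s. fst (z s)) has_vector_derivative v t) (at t within S)" (is ?x)
    and "(v has_vector_derivative
      - (\<alpha> t *\<^sub>R v t + \<beta> *\<^sub>R hessian f (fst (z t)) (v t) + grad f (fst (z t))) /\<^sub>R \<epsilon> t) (at t within S)"
proof -
  have field: "phase_field \<beta> \<epsilon> (\<lambda>s. \<epsilon>' s - \<alpha> s) (grad f) t (z t) =
      (v t, (\<epsilon>' t - \<alpha> t) *\<^sub>R v t - grad f (fst (z t)))"
    by (simp add: phase_field_def v_def)
  show x: ?x
    using bounded_linear.has_vector_derivative[OF bounded_linear_fst z] by (simp add: field)
  have u: "((\<lambda>s. snd (z s)) has_vector_derivative (\<epsilon>' t - \<alpha> t) *\<^sub>R v t - grad f (fst (z t))) (at t within S)"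
    using bounded_linear.has_vector_derivative[OF bounded_linear_snd z] by (simp add: field)
  let ?w' = "(\<epsilon>' t - \<alpha> t) *\<^sub>R v t - grad f (fst (z t)) - \<beta> *\<^sub>R hessian f (fst (z t)) (v t)"
  have w: "((\<lambda>s. snd (z s) - \<beta> *\<^sub>R grad f (fst (z s))) has_vector_derivative ?w') (at t within S)"
    by (intro has_vector_derivative_diff u
        bounded_linear.has_vector_derivative[OF bounded_linear_scaleR_right] grad_chain[OF f x])
  have "((\<lambda>s. inverse (\<epsilon> s)) has_real_derivative - (inverse (\<epsilon> t) * \<epsilon>' t * inverse (\<epsilon> t))) (at t within S)"
    by (rule DERIV_inverse'[OF \<epsilon> \<open>\<epsilon> t \<noteq> 0\<close>])
  then have "(v has_vector_derivative inverse (\<epsilon> t) *\<^sub>R ?w' +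
      (- (inverse (\<epsilon> t) * \<epsilon>' t * inverse (\<epsilon> t))) *\<^sub>R (snd (z t) - \<beta> *\<^sub>R grad f (fst (z t)))) (at t within S)"
    unfolding v_def by (rule has_vector_derivative_scaleR[OF _ w[unfolded v_def]])
  also have "inverse (\<epsilon> t) *\<^sub>R ?w' +
      (- (inverse (\<epsilon> t) * \<epsilon>' t * inverse (\<epsilon> t))) *\<^sub>R (snd (z t) - \<beta> *\<^sub>R grad f (fst (z t)))
    = inverse (\<epsilon> t) *\<^sub>R ?w' - (inverse (\<epsilon> t) * \<epsilon>' t) *\<^sub>R v t"
    by (simp add: v_def)
  also have "\<dots> = - (\<alpha> t *\<^sub>R v t + \<beta> *\<^sub>R hessian f (fst (z t)) (v t) + grad f (fst (z t))) /\<^sub>R \<epsilon> t"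
    by (simp add: algebra_simps)
  finally show "(v has_vector_derivative \<dots>) (at t within S)" .
qed

text \<open>The product and chain rules give
  \<open>\<epsilon> x'' + \<epsilon>' x' + \<beta> H x'\<close> for the derivative of the second
  component, with \<open>H\<close> the Hessian. The equation replaces the first and last summands by
  \<open>- \<alpha> x' - grad f x\<close>, so the Hessian and the second derivative vanish
  together.\<close>

lemma global_solution_imp_phase:
  fixes f :: "'a::euclidean_space \<Rightarrow> real" and \<beta> :: real and \<epsilon> :: "real \<Rightarrow> real"
  defines "z \<equiv> \<lambda>x t. (x t, \<epsilon> t *\<^sub>R time_deriv x t + \<beta> *\<^sub>R grad f (x t))"
  assumes f: "twice_continuously_differentiable f"
    and \<epsilon>: "\<epsilon> differentiable_on {0..}" "\<And>t. t \<ge> 0 \<Longrightarrow> \<epsilon> t \<noteq> 0"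
    and x: "global_solution f \<beta> \<alpha> \<epsilon> x0 v0 x" and "t \<ge> 0"
  shows "(z x has_vector_derivative
    phase_field \<beta> \<epsilon> (\<lambda>s. time_deriv \<epsilon> s - \<alpha> s) (grad f) t (z x t)) (at t within {0..})"
proof -
  let ?v = "time_deriv x"
  have v: "(x has_vector_derivative ?v t) (at t within {0..})"
    and a: "(?v has_vector_derivative time_deriv ?v t) (at t within {0..})"
    using x \<open>t \<ge> 0\<close> by (auto simp: global_solution_def twice_differentiable_def intro!: has_time_deriv)
  have "(\<epsilon> has_real_derivative time_deriv \<epsilon> t) (at t within {0..})"
    using has_time_deriv[OF \<epsilon>(1) \<open>t \<ge> 0\<close>] by (simp add: has_real_derivative_iff_has_vector_derivative)
  then have "((\<lambda>s. \<epsilon> s *\<^sub>R ?v s + \<beta> *\<^sub>R grad f (x s)) has_vector_derivative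
      (\<epsilon> t *\<^sub>R time_deriv ?v t + time_deriv \<epsilon> t *\<^sub>R ?v t) + \<beta> *\<^sub>R hessian f (x t) (?v t)) (at t within {0..})"
    by (intro has_vector_derivative_add has_vector_derivative_scaleR a
        bounded_linear.has_vector_derivative[OF bounded_linear_scaleR_right] grad_chain[OF f v])
  moreover have "(\<epsilon> t *\<^sub>R time_deriv ?v t + time_deriv \<epsilon> t *\<^sub>R ?v t) + \<beta> *\<^sub>R hessian f (x t) (?v t)
      = (time_deriv \<epsilon> t - \<alpha> t) *\<^sub>R ?v t - grad f (x t)"
  proof -
    have "\<epsilon> t *\<^sub>R time_deriv ?v t + \<alpha> t *\<^sub>R ?v t + \<beta> *\<^sub>R hessian f (x t) (?v t) + grad f (x t) = 0"
      using x \<open>t \<ge> 0\<close> by (simp add: global_solution_def)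
    then show ?thesis
      by (simp add: scaleR_diff_left add_eq_0_iff algebra_simps)
  qed
  moreover have "phase_field \<beta> \<epsilon> (\<lambda>s. time_deriv \<epsilon> s - \<alpha> s) (grad f) t (z x t) =
      (?v t, (time_deriv \<epsilon> t - \<alpha> t) *\<^sub>R ?v t - grad f (x t))"
    using \<epsilon>(2)[OF \<open>t \<ge> 0\<close>] by (simp add: phase_field_def z_def Let_def)
  ultimately show ?thesis
    unfolding z_def using has_vector_derivative_Pair[OF v] by simp
qed

text \<open>The velocity recovered from the phase variables is itself differentiable, because the
  gradient is. So the first component of a once differentiable phase curve is twice differentiable,
  and \<open>phase_velocity_deriv\<close> gives its second derivative as the equation solved for
  it.\<close>

lemma phase_imp_global_solution:
  fixes f :: "'a::euclidean_space \<Rightarrow> real" and z :: "real \<Rightarrow> 'a \<times> 'a"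
  assumes f: "twice_continuously_differentiable f"
    and \<epsilon>: "\<epsilon> differentiable_on {0..}" "\<And>t. t \<ge> 0 \<Longrightarrow> \<epsilon> t \<noteq> 0"
    and z: "\<And>t. t \<ge> 0 \<Longrightarrow> (z has_vector_derivative
      phase_field \<beta> \<epsilon> (\<lambda>s. time_deriv \<epsilon> s - \<alpha> s) (grad f) t (z t)) (at t within {0..})"
    and init: "z 0 = (x0, \<epsilon> 0 *\<^sub>R v0 + \<beta> *\<^sub>R grad f x0)"
  shows "global_solution f \<beta> \<alpha> \<epsilon> x0 v0 (\<lambda>t. fst (z t))"
proof -
  define x where "x = (\<lambda>t. fst (z t))"
  define v where "v = (\<lambda>s. (snd (z s) - \<beta> *\<^sub>R grad f (x s)) /\<^sub>R \<epsilon> s)"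
  define a where "a = (\<lambda>t. - (\<alpha> t *\<^sub>R v t + \<beta> *\<^sub>R hessian f (x t) (v t) + grad f (x t)) /\<^sub>R \<epsilon> t)"
  have x: "(x has_vector_derivative v t) (at t within {0..})"
    and v: "(v has_vector_derivative a t) (at t within {0..})" if "t \<ge> 0" for t
  proof -
    have "(\<epsilon> has_real_derivative time_deriv \<epsilon> t) (at t within {0..})"
      using has_time_deriv[OF \<epsilon>(1) that] by (simp add: has_real_derivative_iff_has_vector_derivative)
    from phase_velocity_deriv[OF f z[OF that] this \<epsilon>(2)[OF that]]
    show "(x has_vector_derivative v t) (at t within {0..})" "(v has_vector_derivative a t) (at t within {0..})"
      unfolding x_def v_def a_def by blast+
  qed
  have tx: "time_deriv x t = v t" if "t \<ge> 0" for t
    using time_deriv_eq[OF that x[OF that]] .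
  \<comment> \<open>\<open>time_deriv x\<close> is known to equal \<open>v\<close> only at
    nonnegative times, which suffices for a derivative within the half-line.\<close>
  have tv: "(time_deriv x has_vector_derivative a t) (at t within {0..})" if "t \<ge> 0" for t
    using that by (intro has_vector_derivative_transform[OF _ _ v[OF that]]) (auto simp: tx)
  have "twice_differentiable x"
    unfolding twice_differentiable_def differentiable_on_def
    using x tv by (auto intro: differentiableI_vector)
  moreover have "\<epsilon> t *\<^sub>R time_deriv (time_deriv x) t + \<alpha> t *\<^sub>R time_deriv x t
      + \<beta> *\<^sub>R hessian f (x t) (time_deriv x t) + grad f (x t) = 0" if "t \<ge> 0" for t
    using time_deriv_eq[OF that tv[OF that]] tx[OF that] \<epsilon>(2)[OF that] by (simp add: a_def)
  moreover have "x 0 = x0"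
    using init by (simp add: x_def)
  moreover from this have "time_deriv x 0 = v0"
    using init \<epsilon>(2)[of 0] by (simp add: tx v_def)
  ultimately show ?thesis
    by (simp add: global_solution_def flip: x_def)
qed

text \<open>On \<open>{0..t}\<close> both solutions lie in a common ball, where the gradient may be
  replaced by a globally Lipschitz truncation. Their phase curves then solve one Lipschitz system
  with the same initial value.\<close>

lemma global_solution_unique:
  fixes f :: "'a::euclidean_space \<Rightarrow> real"
  assumes f: "twice_continuously_differentiable f"
    and \<epsilon>: "\<epsilon> differentiable_on {0..}" "time_deriv \<epsilon> differentiable_on {0..}" "\<And>t. t \<ge> 0 \<Longrightarrow> \<epsilon> t \<noteq> 0"
    and \<alpha>: "continuous_on {0..} \<alpha>"
    and x: "global_solution f \<beta> \<alpha> \<epsilon> x0 v0 x" and y: "global_solution f \<beta> \<alpha> \<epsilon> x0 v0 y" and "t \<ge> 0"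
  shows "x t = y t"
proof -
  define z where "z = (\<lambda>x t. (x t, \<epsilon> t *\<^sub>R time_deriv x t + \<beta> *\<^sub>R grad f (x t)))"
  define F :: "('a \<Rightarrow> 'a) \<Rightarrow> _" where "F = phase_field \<beta> \<epsilon> (\<lambda>s. time_deriv \<epsilon> s - \<alpha> s)"
  have z: "(z w has_vector_derivative F (grad f) s (z w s)) (at s within {0..})"
    if "global_solution f \<beta> \<alpha> \<epsilon> x0 v0 w" "s \<ge> 0" for w s
    unfolding z_def F_def using f \<epsilon>(1,3) that by (rule global_solution_imp_phase)
  have init: "z w 0 = (x0, \<epsilon> 0 *\<^sub>R v0 + \<beta> *\<^sub>R grad f x0)" if "global_solution f \<beta> \<alpha> \<epsilon> x0 v0 w" for w
    using that by (simp add: z_def global_solution_def)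
  have bdd: "bounded (w ` {0..t})" if "global_solution f \<beta> \<alpha> \<epsilon> x0 v0 w" for w
  proof -
    have "w differentiable_on {0..}"
      using that by (simp add: global_solution_def twice_differentiable_def)
    then have "continuous_on {0..t} w"
      by (rule continuous_on_subset[OF differentiable_imp_continuous_on]) auto
    then show ?thesis
      by (intro compact_imp_bounded compact_continuous_image) auto
  qed
  have "bounded (x ` {0..t} \<union> y ` {0..t})"
    using bdd[OF x] bdd[OF y] by simp
  then obtain R where "R > 0" and R: "\<forall>p\<in>x ` {0..t} \<union> y ` {0..t}. norm p \<le> R"
    unfolding bounded_pos by auto
  obtain g K where "K \<ge> 0" and g: "\<And>p q. norm (g p - g q) \<le> K * norm (p - q)"
    and g_eq: "\<And>p. norm p \<le> R \<Longrightarrow> g p = grad f p"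
    using grad_truncation[OF f less_imp_le[OF \<open>R > 0\<close>]] by metis
  have c: "continuous_on {0..t} \<epsilon>" "continuous_on {0..t} (\<lambda>s. time_deriv \<epsilon> s - \<alpha> s)"
    using differentiable_imp_continuous_on[OF \<epsilon>(1)] differentiable_imp_continuous_on[OF \<epsilon>(2)] \<alpha>
    by (auto intro!: continuous_intros elim: continuous_on_subset)
  have nz: "\<epsilon> s \<noteq> 0" if "s \<in> {0..t}" for s
    using \<epsilon>(3) that by simp
  obtain L where L: "\<forall>s\<in>{0..t}. \<forall>p q. norm (F g s p - F g s q) \<le> L * norm (p - q)"
    using phase_field_lipschitz[where g = g, OF c nz \<open>K \<ge> 0\<close> g, of \<beta>] unfolding F_def by auto
  have eq: "F (grad f) s (z w s) = F g s (z w s)" if "s \<in> {0..t}" "w = x \<or> w = y" for s w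
  proof -
    have "norm (w s) \<le> R" using R that by auto
    then show ?thesis by (simp add: F_def phase_field_def z_def g_eq)
  qed
  have deriv: "(z w has_vector_derivative F g s (z w s)) (at s within {0..t})"
    if "s \<in> {0..t}" "w = x \<or> w = y" for s w
  proof -
    have "(z w has_vector_derivative F (grad f) s (z w s)) (at s within {0..})"
      using z[of w s] x y that by auto
    then have "(z w has_vector_derivative F (grad f) s (z w s)) (at s within {0..t})"
      by (rule has_vector_derivative_within_subset) auto
    then show ?thesis using eq[OF that] by simp
  qed
  have "z x t - z y t = 0"
  proof (rule linear_growth_zero[where d = "\<lambda>s. z x s - z y s" and d' = "\<lambda>s. F g s (z x s) - F g s (z y s)" and T = t])
    show "z x 0 - z y 0 = 0"
      using init[OF x] init[OF y] by simp
    fix s assume s: "s \<in> {0..t}"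
    show "((\<lambda>s. z x s - z y s) has_vector_derivative F g s (z x s) - F g s (z y s)) (at s within {0..t})"
      using deriv[OF s] by (intro has_vector_derivative_diff) auto
    show "norm (F g s (z x s) - F g s (z y s)) \<le> L * norm (z x s - z y s)"
      using L s by blast
  qed (use \<open>t \<ge> 0\<close> in auto)
  then show ?thesis by (simp add: z_def prod_eq_iff)
qed

section \<open>Energy and global existence\<close>

text \<open>Taking the inner product of the equation with \<open>v\<close> cancels the gradient term
  against the derivative of \<open>f\<close> along the curve. Three dissipative terms remain, with
  signs given by \<open>\<epsilon>' \<le> 0\<close>, \<open>\<alpha> \<ge> 0\<close> and the
  positive semidefinite Hessian. At the final time the nonnegative kinetic term is dropped.\<close>

lemma phase_energy:
  fixes f :: "'a::euclidean_space \<Rightarrow> real" and z :: "real \<Rightarrow> 'a \<times> 'a"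
    and \<beta> :: real and \<epsilon> \<epsilon>' :: "real \<Rightarrow> real"
  assumes f: "twice_continuously_differentiable f" "strongly_convex_on_bounded f"
    and z: "\<And>t. t \<in> {0..T} \<Longrightarrow> (z has_vector_derivative
      phase_field \<beta> \<epsilon> (\<lambda>s. \<epsilon>' s - \<alpha> s) (grad f) t (z t)) (at t within {0..T})"
    and \<epsilon>: "\<And>t. t \<in> {0..T} \<Longrightarrow> (\<epsilon> has_real_derivative \<epsilon>' t) (at t within {0..T})"
      "\<And>t. t \<in> {0..T} \<Longrightarrow> \<epsilon> t > 0" "\<And>t. t \<in> {0..T} \<Longrightarrow> \<epsilon>' t \<le> 0"
    and "\<beta> \<ge> 0" and \<alpha>: "\<And>t. t \<in> {0..T} \<Longrightarrow> \<alpha> t \<ge> 0" and "T \<ge> 0"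
    and init: "z 0 = (x0, \<epsilon> 0 *\<^sub>R v0 + \<beta> *\<^sub>R grad f x0)"
  shows "f (fst (z T)) \<le> f x0 + \<epsilon> 0 / 2 * (v0 \<bullet> v0)"
proof -
  define v where "v = (\<lambda>s. (snd (z s) - \<beta> *\<^sub>R grad f (fst (z s))) /\<^sub>R \<epsilon> s)"
  define x where "x = (\<lambda>t. fst (z t))"
  define a where "a = (\<lambda>t. - (\<alpha> t *\<^sub>R v t + \<beta> *\<^sub>R hessian f (x t) (v t) + grad f (x t)) /\<^sub>R \<epsilon> t)"
  define E where "E = (\<lambda>t. f (x t) + \<epsilon> t / 2 * (v t \<bullet> v t))"
  define E' where "E' = (\<lambda>t. v t \<bullet> grad f (x t) + (\<epsilon>' t / 2 * (v t \<bullet> v t) + (v t \<bullet> a t + a t \<bullet> v t) * (\<epsilon> t / 2)))"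
  have "E T \<le> E 0"
  proof (rule nonpos_deriv_imp_le[where f = E and f' = E'])
    fix t assume t: "t \<in> {0..T}"
    have "\<epsilon> t \<noteq> 0" using \<epsilon>(2)[OF t] by simp
    note deriv = phase_velocity_deriv[OF f(1) z[OF t] \<epsilon>(1)[OF t] this]
    have x: "(x has_vector_derivative v t) (at t within {0..T})"
      and v: "(v has_vector_derivative a t) (at t within {0..T})"
      using deriv unfolding x_def v_def a_def by blast+
    have "f differentiable (at (x t))"
      using f(1) by (auto simp: twice_continuously_differentiable_def differentiable_on_def)
    then have "(f has_derivative (\<lambda>h. h \<bullet> grad f (x t))) (at (x t))"
      using GDERIV_grad by (auto simp: gderiv_def)
    from has_derivative_compose[OF x[unfolded has_vector_derivative_def] this]
    have fx: "((\<lambda>s. f (x s)) has_real_derivative v t \<bullet> grad f (x t)) (at t within {0..T})"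
      by (simp add: has_field_derivative_def mult_commute_abs)
    have "((\<lambda>s. v s \<bullet> v s) has_real_derivative v t \<bullet> a t + a t \<bullet> v t) (at t within {0..T})"
      using bounded_bilinear.has_vector_derivative[OF bounded_bilinear_inner v v]
      by (simp add: has_real_derivative_iff_has_vector_derivative)
    then show "(E has_real_derivative E' t) (at t within {0..T})"
      unfolding E_def E'_def
      by (intro DERIV_add fx DERIV_mult DERIV_cdivide \<epsilon>(1)[OF t])
    have "\<epsilon> t *\<^sub>R a t = - (\<alpha> t *\<^sub>R v t + \<beta> *\<^sub>R hessian f (x t) (v t) + grad f (x t))"
      using \<open>\<epsilon> t \<noteq> 0\<close> by (simp add: a_def)
    from arg_cong[OF this, of "inner (v t)"]
    have "\<epsilon> t * (v t \<bullet> a t) = - (\<alpha> t * (v t \<bullet> v t) + \<beta> * (v t \<bullet> hessian f (x t) (v t)) + v t \<bullet> grad f (x t))"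
      by (simp add: inner_add_right inner_diff_right)
    then have "E' t = \<epsilon>' t / 2 * (v t \<bullet> v t) - \<alpha> t * (v t \<bullet> v t) - \<beta> * (v t \<bullet> hessian f (x t) (v t))"
      unfolding E'_def by (simp add: inner_commute[of "a t"] algebra_simps)
    moreover have "\<epsilon>' t / 2 * (v t \<bullet> v t) \<le> 0" "0 \<le> \<alpha> t * (v t \<bullet> v t)" "0 \<le> \<beta> * (v t \<bullet> hessian f (x t) (v t))"
      using \<epsilon>(3)[OF t] \<alpha>[OF t] \<open>\<beta> \<ge> 0\<close> hessian_nonneg[OF f] by (auto intro!: mult_nonneg_nonneg mult_nonpos_nonneg)
    ultimately show "E' t \<le> 0" by linarith
  qed (use \<open>T \<ge> 0\<close> in auto)
  moreover have "0 \<le> \<epsilon> T / 2 * (v T \<bullet> v T)"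
    using \<epsilon>(2)[of T] \<open>T \<ge> 0\<close> by (intro mult_nonneg_nonneg) auto
  moreover have "v 0 = v0"
    using init \<epsilon>(2)[of 0] \<open>T \<ge> 0\<close> by (simp add: v_def)
  ultimately show ?thesis
    by (simp add: E_def x_def init)
qed

theorem theorem2p1:
  fixes f :: "'a::euclidean_space \<Rightarrow> real"
    and \<beta> :: real
    and x0 v0 :: 'a
    and \<alpha> \<epsilon> :: "real \<Rightarrow> real"
  assumes "convex_on UNIV f"
    and "twice_continuously_differentiable f"
    and "coercive f"
    and "strongly_convex_on_bounded f"
    and "\<beta> > 0"
    and "antimono_on {0..} \<alpha>"
    and "\<forall>t\<ge>0. \<alpha> t \<ge> 0"
    and "\<alpha> differentiable_on {0..}"
    and "antimono_on {0..} \<epsilon>"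
    and "\<forall>t\<ge>0. \<epsilon> t > 0"
    and "twice_differentiable \<epsilon>"
    and "bounded (time_deriv (time_deriv \<epsilon>) ` {0..})"
  shows "\<exists>x. global_solution f \<beta> \<alpha> \<epsilon> x0 v0 x \<and>
             (\<forall>y. global_solution f \<beta> \<alpha> \<epsilon> x0 v0 y \<longrightarrow> (\<forall>t\<ge>0. y t = x t))"
proof -
  note f = assms(2)
  have \<epsilon>_diff: "\<epsilon> differentiable_on {0..}" "time_deriv \<epsilon> differentiable_on {0..}"
    using assms(11) by (auto simp: twice_differentiable_def)
  have \<epsilon>_pos: "\<epsilon> t > 0" if "t \<ge> 0" for t
    using assms(10) that by simp
  then have \<epsilon>_nz: "\<epsilon> t \<noteq> 0" if "t \<ge> 0" for t
    using that by fastforce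
  have \<alpha>: "continuous_on {0..} \<alpha>"
    using assms(8) by (rule differentiable_imp_continuous_on)
  define \<gamma> where "\<gamma> = (\<lambda>t. time_deriv \<epsilon> t - \<alpha> t)"
  have c: "continuous_on {0..} \<epsilon>" "continuous_on {0..} \<gamma>"
    unfolding \<gamma>_def by (intro continuous_on_diff \<alpha> differentiable_imp_continuous_on \<epsilon>_diff)+
  \<comment> \<open>The initial energy; the corresponding sublevel set of \<open>f\<close> supplies
    the a priori radius \<open>R\<close>.\<close>
  define E0 where "E0 = f x0 + \<epsilon> 0 / 2 * (v0 \<bullet> v0)"
  obtain R where "R > 0" and R: "\<And>x. f x \<le> E0 \<Longrightarrow> norm x \<le> R"
    by (rule coercive_sublevel_bounded[OF assms(3), of E0]) (rule that)
  \<comment> \<open>The truncation radius exceeds the a priori radius by 1; this margin yields the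
    contradiction when the curve first reaches radius \<open>R + 1\<close>.\<close>
  obtain g K where "K \<ge> 0" and g: "\<And>p q. norm (g p - g q) \<le> K * norm (p - q)"
    and g_eq: "\<And>p. norm p \<le> R + 1 \<Longrightarrow> g p = grad f p"
    using grad_truncation[OF f, of "R + 1"] \<open>R > 0\<close> by (metis add_nonneg_nonneg less_imp_le zero_le_one)
  have "K-lipschitz_on UNIV g"
    using g \<open>K \<ge> 0\<close> by (intro lipschitz_onI) (auto simp: dist_norm)
  then have "continuous_on UNIV g"
    by (rule lipschitz_on_continuous_on)
  from continuous_phase_field[OF c this \<epsilon>_nz]
  have cont: "continuous_on ({0..} \<times> UNIV) (\<lambda>(t, z). phase_field \<beta> \<epsilon> \<gamma> g t z)"
    by simp
  have lip: "\<exists>L. \<forall>t\<in>{0..T}. \<forall>z w.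
      norm (phase_field \<beta> \<epsilon> \<gamma> g t z - phase_field \<beta> \<epsilon> \<gamma> g t w) \<le> L * norm (z - w)" for T
  proof (rule phase_field_lipschitz[OF _ _ _ \<open>K \<ge> 0\<close> g])
    show "continuous_on {0..T} \<epsilon>" "continuous_on {0..T} \<gamma>"
      by (rule continuous_on_subset[OF c(1)] continuous_on_subset[OF c(2)], simp)+
  qed (use \<epsilon>_nz in simp)
  \<comment> \<open>The initial data \<open>x0\<close>, \<open>v0\<close> are translated into the
    phase variables.\<close>
  obtain z where init: "z 0 = (x0, \<epsilon> 0 *\<^sub>R v0 + \<beta> *\<^sub>R grad f x0)"
    and z: "\<And>t. t \<ge> 0 \<Longrightarrow> (z has_vector_derivative phase_field \<beta> \<epsilon> \<gamma> g t (z t)) (at t within {0..})"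
    by (rule ode_exists_halfline[OF cont lip, of "(x0, \<epsilon> 0 *\<^sub>R v0 + \<beta> *\<^sub>R grad f x0)"]) (rule that)
  define r where "r = (\<lambda>t. norm (fst (z t)))"
  have "continuous_on {0..} z"
    unfolding continuous_on_eq_continuous_within
    using has_vector_derivative_continuous[OF z] by simp
  then have r_cont: "continuous_on {0..} r"
    unfolding r_def by (intro continuous_intros)
  have field_eq: "phase_field \<beta> \<epsilon> \<gamma> g t (z t) = phase_field \<beta> \<epsilon> \<gamma> (grad f) t (z t)" if "r t \<le> R + 1" for t
    using that by (simp add: phase_field_def g_eq r_def)
  have "f x0 \<le> E0"
    using \<epsilon>_pos[of 0] by (simp add: E0_def)
  then have "r 0 \<le> R"
    using R init by (simp add: r_def)
  \<comment> \<open>Starting at radius at most \<open>R\<close>, the curve cannot get beyond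
    \<open>R + 1\<close> without touching that sphere, by the intermediate value theorem.\<close>
  have hits: "\<exists>s. 0 \<le> s \<and> s \<le> t \<and> r s = R + 1" if "t \<ge> 0" "r t \<ge> R + 1" for t
    using that \<open>r 0 \<le> R\<close> by (intro IVT' continuous_on_subset[OF r_cont]) auto
  have bound: "r t \<le> R + 1" if "t \<ge> 0" for t
  proof (rule ccontr)
    assume "\<not> r t \<le> R + 1"
    \<comment> \<open>The times spent on the sphere form a nonempty compact set, whose least element
      is the first hitting time.\<close>
    define S where "S = {s \<in> {0..t}. r s = R + 1}"
    have "closed S"
      unfolding S_def by (intro continuous_closed_preimage_constant continuous_on_subset[OF r_cont]) auto
    then have "compact S"
      by (intro compact_eq_bounded_closed[THEN iffD2] conjI bounded_subset[of "{0..t}" S]) (auto simp: S_def)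
    moreover have "S \<noteq> {}"
      using hits[OF that] \<open>\<not> r t \<le> R + 1\<close> by (auto simp: S_def)
    ultimately have "\<exists>\<tau>\<in>S. \<forall>s\<in>S. \<tau> \<le> s"
      by (rule compact_attains_inf)
    then obtain \<tau> where \<tau>: "\<tau> \<in> S" and least: "\<forall>s\<in>S. \<tau> \<le> s"
      by auto
    \<comment> \<open>An excursion beyond \<open>R + 1\<close> is preceded by a hit of the sphere;
      minimality of \<tau> then leaves only \<tau> itself as its time, where the radius is exactly
      \<open>R + 1\<close>.\<close>
    have before: "r s \<le> R + 1" if s: "s \<in> {0..\<tau>}" for s
    proof (rule ccontr)
      assume "\<not> r s \<le> R + 1"
      then obtain s' where s': "0 \<le> s'" "s' \<le> s" "r s' = R + 1"
        using hits[of s] s by auto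
      then have "s' \<in> S" using s \<tau> by (auto simp: S_def)
      then have "\<tau> \<le> s'" using least by simp
      then have "s = \<tau>" using s s' by simp
      then show False using \<tau> \<open>\<not> r s \<le> R + 1\<close> by (simp add: S_def)
    qed
    \<comment> \<open>Up to \<tau> the truncated field equals the true one along the curve, so the
      energy estimate applies and forces radius at most \<open>R\<close> at time \<tau>.\<close>
    have "f (fst (z \<tau>)) \<le> E0"
      unfolding E0_def
    proof (rule phase_energy[OF f assms(4), where \<epsilon>' = "time_deriv \<epsilon>" and \<alpha> = \<alpha>])
      fix s assume s: "s \<in> {0..\<tau>}"
      then show "(z has_vector_derivative
          phase_field \<beta> \<epsilon> (\<lambda>s. time_deriv \<epsilon> s - \<alpha> s) (grad f) s (z s)) (at s within {0..\<tau>})"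
        using has_vector_derivative_within_subset[OF z[of s], of "{0..\<tau>}"] field_eq[OF before[OF s]]
        by (auto simp: \<gamma>_def)
      show "(\<epsilon> has_real_derivative time_deriv \<epsilon> s) (at s within {0..\<tau>})"
        using has_vector_derivative_within_subset[OF has_time_deriv[OF \<epsilon>_diff(1), of s], of "{0..\<tau>}"] s
        by (auto simp: has_real_derivative_iff_has_vector_derivative)
      show "time_deriv \<epsilon> s \<le> 0"
        using time_deriv_nonpos[OF assms(9) \<epsilon>_diff(1)] s by simp
      show "\<epsilon> s > 0" "\<alpha> s \<ge> 0"
        using s \<epsilon>_pos assms(7) by auto
    qed (use \<tau> assms(5) init in \<open>auto simp: S_def\<close>)
    then have "r \<tau> \<le> R"
      unfolding r_def by (rule R)
    then show False using \<tau> by (simp add: S_def)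
  qed
  \<comment> \<open>The truncation is inactive along the curve at all times, so the curve solves the
    original first-order system.\<close>
  have "global_solution f \<beta> \<alpha> \<epsilon> x0 v0 (\<lambda>t. fst (z t))"
  proof (rule phase_imp_global_solution[where z = z, OF f \<epsilon>_diff(1)])
    show "(z has_vector_derivative
        phase_field \<beta> \<epsilon> (\<lambda>s. time_deriv \<epsilon> s - \<alpha> s) (grad f) t (z t)) (at t within {0..})" if "t \<ge> 0" for t
      using z[OF that] field_eq[OF bound[OF that]] unfolding \<gamma>_def by simp
  qed (use \<epsilon>_nz init in auto)
  moreover from this have "y t = fst (z t)" if "global_solution f \<beta> \<alpha> \<epsilon> x0 v0 y" "t \<ge> 0" for y t
    using global_solution_unique[OF f \<epsilon>_diff \<epsilon>_nz \<alpha> that(1) _ that(2)] by simp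
  ultimately show ?thesis by blast
qed

end
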